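(* A category with moment structure $(m_A,f_* )$ enjoys the following properties: (i) For each object $A$ the moment set $m_A$ is a monoid under composition such that $\phi\psi=\phi\psi\phi$ for all $\phi,\psi\in m_A$. In particular, each moment is idempotent. (ii) For any $\phi,\psi\in m_A$ the relations $\psi\phi=\phi$ and $\phi\psi=\psi$ jointly imply $\phi=\psi$. (iii) An endomorphism $\phi$ of $A$ belongs to $m_A$ if and only if $\phi_*(1_A)=\phi$. For any morphism $f:A\to B$ and any $\phi\in m_A$ one has $f_*(\phi)=(f\phi)_*(1_A)$. (iv) Epimorphisms are active. (v) For any splitting $i:B\rightleftarrows A:r$ of a moment $\phi\in m_A$ (so $ir=\phi$, $ri=1_B$), the retraction $r$ is active and the section $i$ is inert. In particular, $r_*(\phi)=1_B$ and $i_*(1_B)=\phi$. (vi) The class of active (resp. inert) morphisms is closed, i.e. closed under composition and contains all isomorphisms. (vii) A morphism $f:A\to B$ has an active/inert factorisation (i.e. $f=ig$ with $g$ active and $i$ inert) if and only if the moment $f_*(1_A)$ splits.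
   Context: A moment structure on a category consists in specifying for each object $A$ a set $m_A$ of endomorphisms of $A$, called moments, and for each morphism $f:A\to B$ a pushforward operation $f_*:m_A\to m_B$ such that, for all $A$, $\phi,\psi\in m_A$, $f:A\to B$, $g:B\to C$: (m1) $1_A\in m_A$; (m2) $\phi_*(\psi)=\phi\psi$; (m3) $(gf)_*=g_*f_*$; (m4) $f\phi=f_*(\phi)f$. A morphism $f:A\to B$ is active if $f_*(1_A)=1_B$, and inert if $f$ admits a retraction $r:B\to A$ such that $f_*(\phi)=f\phi r$ for all $\phi\in m_A$. A moment $\phi$ of $A$ splits over $B$ if there are $i:B\to A$, $r:A\to B$ with $ir=\phi$ and $ri=1_B$. *)

theory Defs
  imports "HOL-Algebra.Group"
begin

record ('o, 'm) category =
  Obj :: "'o set"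
  Arr :: "'m set"
  Dom :: "'m \<Rightarrow> 'o"
  Cod :: "'m \<Rightarrow> 'o"
  Ident :: "'o \<Rightarrow> 'm"
  Comp :: "'m \<Rightarrow> 'm \<Rightarrow> 'm" (infixl "\<bullet>\<index>" 70)

text \<open>Composition is applicative: \<open>g \<bullet> f\<close> means first \<open>f\<close>, then \<open>g\<close>. All fields are total
  functions; their values outside \<open>Obj\<close>, \<open>Arr\<close> and the composable pairs are irrelevant.\<close>

definition Hom :: "('o, 'm, 'z) category_scheme \<Rightarrow> 'o \<Rightarrow> 'o \<Rightarrow> 'm set" where
  "Hom C A B = {f \<in> Arr C. Dom C f = A \<and> Cod C f = B}"

locale category =
  fixes C :: "('o, 'm, 'z) category_scheme" (structure)
  assumes dom_obj: "f \<in> Arr C \<Longrightarrow> Dom C f \<in> Obj C"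
    and cod_obj: "f \<in> Arr C \<Longrightarrow> Cod C f \<in> Obj C"
    and ident_hom: "A \<in> Obj C \<Longrightarrow> Ident C A \<in> Hom C A A"
    and comp_hom: "\<lbrakk>f \<in> Hom C A B; g \<in> Hom C B D\<rbrakk> \<Longrightarrow> g \<bullet> f \<in> Hom C A D"
    and ident_right: "f \<in> Hom C A B \<Longrightarrow> f \<bullet> Ident C A = f"
    and ident_left: "f \<in> Hom C A B \<Longrightarrow> Ident C B \<bullet> f = f"
    and comp_assoc: "\<lbrakk>f \<in> Hom C A B; g \<in> Hom C B D; h \<in> Hom C D E\<rbrakk>
      \<Longrightarrow> (h \<bullet> g) \<bullet> f = h \<bullet> (g \<bullet> f)"

definition epimorphism :: "('o, 'm, 'z) category_scheme \<Rightarrow> 'm \<Rightarrow> bool" where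
  "epimorphism C f \<longleftrightarrow> f \<in> Arr C \<and>
    (\<forall>D. \<forall>g \<in> Hom C (Cod C f) D. \<forall>h \<in> Hom C (Cod C f) D.
      g \<bullet>\<^bsub>C\<^esub> f = h \<bullet>\<^bsub>C\<^esub> f \<longrightarrow> g = h)"

definition isomorphism :: "('o, 'm, 'z) category_scheme \<Rightarrow> 'm \<Rightarrow> bool" where
  "isomorphism C f \<longleftrightarrow> f \<in> Arr C \<and>
    (\<exists>g \<in> Hom C (Cod C f) (Dom C f).
      g \<bullet>\<^bsub>C\<^esub> f = Ident C (Dom C f) \<and> f \<bullet>\<^bsub>C\<^esub> g = Ident C (Cod C f))"

definition closed_class :: "('o, 'm, 'z) category_scheme \<Rightarrow> 'm set \<Rightarrow> bool" where
  "closed_class C S \<longleftrightarrow>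
    (\<forall>f \<in> S. \<forall>g \<in> S. Dom C g = Cod C f \<longrightarrow> g \<bullet>\<^bsub>C\<^esub> f \<in> S) \<and>
    (\<forall>f. isomorphism C f \<longrightarrow> f \<in> S)"

record ('o, 'm) moment_category = "('o, 'm) category" +
  Mom :: "'o \<Rightarrow> 'm set"
  push :: "'m \<Rightarrow> 'm \<Rightarrow> 'm"

text \<open>\<open>push C f \<phi>\<close> is the pushforward \<open>f\<^sub>*(\<phi>)\<close>; it is meaningful for \<open>\<phi> \<in> Mom C (Dom C f)\<close>.\<close>

locale moment_category = category C
  for C :: "('o, 'm, 'z) moment_category_scheme" (structure) +
  assumes mom_endo: "A \<in> Obj C \<Longrightarrow> Mom C A \<subseteq> Hom C A A"
    and push_mom: "\<lbrakk>f \<in> Hom C A B; \<phi> \<in> Mom C A\<rbrakk> \<Longrightarrow> push C f \<phi> \<in> Mom C B"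
    and m1: "A \<in> Obj C \<Longrightarrow> Ident C A \<in> Mom C A"
    and m2: "\<lbrakk>A \<in> Obj C; \<phi> \<in> Mom C A; \<psi> \<in> Mom C A\<rbrakk> \<Longrightarrow> push C \<phi> \<psi> = \<phi> \<bullet> \<psi>"
    and m3: "\<lbrakk>f \<in> Hom C A B; g \<in> Hom C B D; \<phi> \<in> Mom C A\<rbrakk>
      \<Longrightarrow> push C (g \<bullet> f) \<phi> = push C g (push C f \<phi>)"
    and m4: "\<lbrakk>f \<in> Hom C A B; \<phi> \<in> Mom C A\<rbrakk> \<Longrightarrow> f \<bullet> \<phi> = push C f \<phi> \<bullet> f"

definition active :: "('o, 'm, 'z) moment_category_scheme \<Rightarrow> 'm \<Rightarrow> bool" where
  "active C f \<longleftrightarrow> f \<in> Arr C \<and> push C f (Ident C (Dom C f)) = Ident C (Cod C f)"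

definition inert :: "('o, 'm, 'z) moment_category_scheme \<Rightarrow> 'm \<Rightarrow> bool" where
  "inert C f \<longleftrightarrow> f \<in> Arr C \<and>
    (\<exists>r \<in> Hom C (Cod C f) (Dom C f). r \<bullet>\<^bsub>C\<^esub> f = Ident C (Dom C f) \<and>
      (\<forall>\<phi> \<in> Mom C (Dom C f). push C f \<phi> = f \<bullet>\<^bsub>C\<^esub> \<phi> \<bullet>\<^bsub>C\<^esub> r))"

definition splitting ::
  "('o, 'm, 'z) category_scheme \<Rightarrow> 'o \<Rightarrow> 'm \<Rightarrow> 'o \<Rightarrow> 'm \<Rightarrow> 'm \<Rightarrow> bool" where
  "splitting C A \<phi> B i r \<longleftrightarrow>
    i \<in> Hom C B A \<and> r \<in> Hom C A B \<and> i \<bullet>\<^bsub>C\<^esub> r = \<phi> \<and> r \<bullet>\<^bsub>C\<^esub> i = Ident C B"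

definition splits :: "('o, 'm, 'z) category_scheme \<Rightarrow> 'o \<Rightarrow> 'm \<Rightarrow> bool" where
  "splits C A \<phi> \<longleftrightarrow> (\<exists>B \<in> Obj C. \<exists>i r. splitting C A \<phi> B i r)"

definition has_active_inert_factorisation ::
  "('o, 'm, 'z) moment_category_scheme \<Rightarrow> 'm \<Rightarrow> bool" where
  "has_active_inert_factorisation C f \<longleftrightarrow>
    (\<exists>B \<in> Obj C. \<exists>g \<in> Hom C (Dom C f) B. \<exists>i \<in> Hom C B (Cod C f).
      active C g \<and> inert C i \<and> f = i \<bullet>\<^bsub>C\<^esub> g)"

end

theory Submission
  imports Defs
begin

text \<open>
  Axiom (m4) at the identity moment reads \<open>f = f\<^sub>*(1) f\<close>, so epimorphisms are active; (m2) and (m4)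
  for a moment \<open>\<phi>\<close> give \<open>\<phi>\<psi> = \<phi>\<psi>\<phi>\<close>. If \<open>i r = \<phi>\<close> is a splitting, then \<open>r\<close> is a split
  epimorphism, hence active, so that \<open>i\<^sub>*(1) = i\<^sub>*(r\<^sub>*(1)) = \<phi>\<^sub>*(1) = \<phi>\<close>, and
  \<open>i \<psi> r = i\<^sub>*(\<psi>) i r = i\<^sub>*(\<psi>) i\<^sub>*(1) = (i\<^sub>*(\<psi>) i)\<^sub>*(1) = (i \<psi>)\<^sub>*(1) = i\<^sub>*(\<psi>)\<close>. A splitting
  of \<open>f\<^sub>*(1)\<close> factors \<open>f\<close> as \<open>i (r f)\<close>.
\<close>

lemma HomI: "f \<in> Arr C \<Longrightarrow> f \<in> Hom C (Dom C f) (Cod C f)"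
  by (simp add: Hom_def)

lemma HomD:
  assumes "f \<in> Hom C A B"
  shows "f \<in> Arr C" "Dom C f = A" "Cod C f = B"
  using assms by (simp_all add: Hom_def)

section \<open>Sections and cancellation in a category\<close>

context category
begin

lemma Hom_obj:
  assumes "f \<in> Hom C A B"
  shows "A \<in> Obj C" "B \<in> Obj C"
  using assms dom_obj cod_obj by (auto simp: Hom_def)

text \<open>Composing with the section \<open>i\<close> cancels \<open>r\<close> on the right:
  \<open>g = (g r) i\<close>.\<close>

lemma split_epi_epimorphism:
  assumes r: "r \<in> Hom C A B" and i: "i \<in> Hom C B A" and ri: "r \<bullet> i = Ident C B"
  shows "epimorphism C r"
  unfolding epimorphism_def HomD[OF r]
proof (intro conjI allI ballI impI)
  fix D g h
  assume g: "g \<in> Hom C B D" and h: "h \<in> Hom C B D" and eq: "g \<bullet> r = h \<bullet> r"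
  have "g = (g \<bullet> r) \<bullet> i"
    by (simp add: comp_assoc[OF i r g] ri ident_right[OF g])
  also have "\<dots> = h"
    by (simp add: eq comp_assoc[OF i r h] ri ident_right[OF h])
  finally show "g = h" .
qed (rule HomD[OF r])

end

section \<open>The monoid of moments and pushforwards of identities\<close>

context moment_category
begin

lemma mom_hom: "A \<in> Obj C \<Longrightarrow> \<phi> \<in> Mom C A \<Longrightarrow> \<phi> \<in> Hom C A A"
  using mom_endo by blast

lemma mom_comp: "A \<in> Obj C \<Longrightarrow> \<phi> \<in> Mom C A \<Longrightarrow> \<psi> \<in> Mom C A \<Longrightarrow> \<phi> \<bullet> \<psi> \<in> Mom C A"
  by (subst m2[symmetric]) (auto intro: push_mom mom_hom)

lemma mom_skew_commute:
  assumes "A \<in> Obj C" "\<phi> \<in> Mom C A" "\<psi> \<in> Mom C A"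
  shows "\<phi> \<bullet> \<psi> = \<phi> \<bullet> \<psi> \<bullet> \<phi>"
  using m4[OF mom_hom[OF assms(1,2)] assms(3)] unfolding m2[OF assms] .

text \<open>This is the law \<open>\<phi>\<psi> = \<phi>\<psi>\<phi>\<close> at
  \<open>\<psi> = 1\<close>.\<close>

lemma mom_idem:
  assumes "A \<in> Obj C" "\<phi> \<in> Mom C A"
  shows "\<phi> \<bullet> \<phi> = \<phi>"
  using mom_skew_commute[OF assms m1] assms by (simp add: ident_right[OF mom_hom])

lemma mom_monoid:
  assumes A: "A \<in> Obj C"
  shows "monoid \<lparr>carrier = Mom C A, mult = Comp C, one = Ident C A\<rparr>"
  by (rule monoidI)
    (simp_all add: A mom_comp m1 comp_assoc[OF mom_hom[OF A] mom_hom[OF A] mom_hom[OF A]]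
      ident_left[OF mom_hom] ident_right[OF mom_hom])

text \<open>Under both hypotheses the law \<open>\<phi>\<psi> = \<phi>\<psi>\<phi>\<close> collapses
  to \<open>\<psi> = \<phi>\<close>. This is antisymmetry of the relation
  \<open>\<psi>\<phi> = \<phi>\<close> between moments.\<close>

lemma mom_antisym:
  assumes A: "A \<in> Obj C" and \<phi>: "\<phi> \<in> Mom C A" and \<psi>: "\<psi> \<in> Mom C A"
    and 1: "\<psi> \<bullet> \<phi> = \<phi>" and 2: "\<phi> \<bullet> \<psi> = \<psi>"
  shows "\<phi> = \<psi>"
  using mom_skew_commute[OF A \<phi> \<psi>] mom_idem[OF A \<phi>] 1 2 by simp

lemma push_ident_mom:
  assumes "A \<in> Obj C" "\<phi> \<in> Mom C A"
  shows "push C \<phi> (Ident C A) = \<phi>"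
  using assms by (simp add: m2 m1 ident_right[OF mom_hom])

text \<open>A pushforward of an identity is always a moment, so an endomorphism that equals its own
  such pushforward is one too.\<close>

lemma mom_iff_push_ident:
  assumes "A \<in> Obj C" "\<phi> \<in> Hom C A A"
  shows "\<phi> \<in> Mom C A \<longleftrightarrow> push C \<phi> (Ident C A) = \<phi>"
  using assms push_ident_mom push_mom[OF _ m1] by metis

text \<open>Write \<phi> as \<open>\<phi>\<^sub>*(1)\<close> and merge the two pushforwards by
  (m3).\<close>

lemma push_eq_push_ident:
  assumes f: "f \<in> Hom C A B" and \<phi>: "\<phi> \<in> Mom C A"
  shows "push C f \<phi> = push C (f \<bullet> \<phi>) (Ident C A)"
proof -
  note A = Hom_obj(1)[OF f]
  show ?thesis
    by (simp add: m3[OF mom_hom[OF A \<phi>] f m1[OF A]] push_ident_mom[OF A \<phi>])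
qed

lemma push_ident_comp:
  assumes f: "f \<in> Hom C A B"
  shows "push C f (Ident C A) \<bullet> f = f"
  using m4[OF f m1] Hom_obj(1)[OF f] ident_right[OF f] by simp

lemma epimorphism_active:
  assumes f: "epimorphism C f"
  shows "active C f"
proof -
  have fh: "f \<in> Hom C (Dom C f) (Cod C f)"
    using f by (simp add: epimorphism_def HomI)
  note obj = Hom_obj[OF fh]
  have "push C f (Ident C (Dom C f)) \<bullet> f = Ident C (Cod C f) \<bullet> f"
    by (simp add: push_ident_comp[OF fh] ident_left[OF fh])
  \<comment> \<open>Cancelling \<open>f\<close> requires both left factors to be endomorphisms of
    its codomain.\<close>
  moreover have "push C f (Ident C (Dom C f)) \<in> Hom C (Cod C f) (Cod C f)"
    by (rule mom_hom[OF obj(2) push_mom[OF fh m1[OF obj(1)]]])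
  ultimately show ?thesis
    using f ident_hom[OF obj(2)] unfolding epimorphism_def active_def by blast
qed

lemma push_active:
  assumes "active C f" "f \<in> Hom C A B"
  shows "push C f (Ident C A) = Ident C B"
  using assms HomD[OF assms(2)] by (simp add: active_def)

section \<open>A fixed splitting of a moment\<close>

context
  fixes A B \<phi> i r
  assumes split: "splitting C A \<phi> B i r" and \<phi>: "\<phi> \<in> Mom C A"
begin

private lemma
  ih: "i \<in> Hom C B A" and rh: "r \<in> Hom C A B"
  and ir: "i \<bullet> r = \<phi>" and ri: "r \<bullet> i = Ident C B"
  using split by (simp_all add: splitting_def)

private lemma A: "A \<in> Obj C" and B: "B \<in> Obj C"
  using Hom_obj[OF rh] .

lemma splitting_retraction_active: "active C r"
  by (rule epimorphism_active[OF split_epi_epimorphism[OF rh ih ri]])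

lemma splitting_push_section: "push C i (Ident C B) = \<phi>"
  using m3[OF rh ih m1[OF A]] push_active[OF splitting_retraction_active rh]
  by (simp add: ir push_ident_mom[OF A \<phi>])

text \<open>Since \<open>r \<phi> = r i r = r\<close>, pushing \<phi> along \<open>r\<close> is the
  same as pushing the identity along the active \<open>r\<close>.\<close>

lemma splitting_push_retraction: "push C r \<phi> = Ident C B"
proof -
  have "r \<bullet> \<phi> = r"
    using comp_assoc[OF rh ih rh] by (simp add: ir ri ident_left[OF rh])
  then show ?thesis
    by (simp add: push_eq_push_ident[OF rh \<phi>] push_active[OF splitting_retraction_active rh])
qed

lemma splitting_section_inert: "inert C i"
  unfolding inert_def HomD[OF ih]
proof (intro conjI bexI[of _ r] ballI)
  fix \<psi> assume \<psi>: "\<psi> \<in> Mom C B"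
  let ?\<chi> = "push C i \<psi>"
  have \<chi>: "?\<chi> \<in> Mom C A" and \<chi>h: "?\<chi> \<in> Hom C A A"
    using push_mom[OF ih \<psi>] mom_hom[OF A] by blast+
  have "i \<bullet> \<psi> \<bullet> r = ?\<chi> \<bullet> i \<bullet> r"
    by (simp add: m4[OF ih \<psi>])
  also have "\<dots> = ?\<chi> \<bullet> \<phi>"
    by (simp add: comp_assoc[OF rh ih \<chi>h] ir)
  \<comment> \<open>Here (m2) is read backwards: once the product of moments is a pushforward, (m3)
    can fuse it with \<open>i\<close>.\<close>
  also have "\<dots> = push C ?\<chi> (push C i (Ident C B))"
    by (simp add: m2[OF A \<chi> \<phi>] splitting_push_section)
  also have "\<dots> = push C (i \<bullet> \<psi>) (Ident C B)"
    by (simp add: m3[OF ih \<chi>h m1[OF B]] m4[OF ih \<psi>])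
  also have "\<dots> = ?\<chi>"
    by (simp add: push_eq_push_ident[OF ih \<psi>])
  finally show "?\<chi> = i \<bullet> \<psi> \<bullet> r" ..
qed (simp_all add: ri rh HomD[OF ih])

end

text \<open>Evaluating the inertness formula at the identity moment gives
  \<open>i\<^sub>*(1) = i r\<close>. This is what makes a moment split when an active/inert
  factorisation is given.\<close>

lemma inert_splitting:
  assumes i: "inert C i" and ih: "i \<in> Hom C B A"
  obtains r where "splitting C A (push C i (Ident C B)) B i r"
proof -
  obtain r where "r \<in> Hom C A B" "r \<bullet> i = Ident C B"
    "push C i (Ident C B) = i \<bullet> Ident C B \<bullet> r"
    using i m1[OF Hom_obj(1)[OF ih]] unfolding inert_def HomD[OF ih] by blast
  then show thesis
    using that ih by (simp add: splitting_def ident_right)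
qed

section \<open>Closure of the active and of the inert morphisms\<close>

lemma iso_splitting:
  assumes "isomorphism C f"
  obtains g where "splitting C (Cod C f) (Ident C (Cod C f)) (Dom C f) f g"
    and "splitting C (Dom C f) (Ident C (Dom C f)) (Cod C f) g f"
  using assms unfolding isomorphism_def splitting_def by (auto dest: HomI)

lemma iso_obj:
  assumes "isomorphism C f"
  shows "Dom C f \<in> Obj C" "Cod C f \<in> Obj C"
  using assms by (simp_all add: isomorphism_def dom_obj cod_obj)

text \<open>An isomorphism is the retraction in a splitting of the identity moment of its domain,
  with its inverse as section.\<close>

lemma iso_active:
  assumes f: "isomorphism C f"
  shows "active C f"
proof -
  obtain g where "splitting C (Dom C f) (Ident C (Dom C f)) (Cod C f) g f"
    using iso_splitting[OF f] .
  then show ?thesis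
    by (rule splitting_retraction_active) (rule m1[OF iso_obj(1)[OF f]])
qed

text \<open>Dually, it is the section in a splitting of the identity moment of its codomain.\<close>

lemma iso_inert:
  assumes f: "isomorphism C f"
  shows "inert C f"
proof -
  obtain g where "splitting C (Cod C f) (Ident C (Cod C f)) (Dom C f) f g"
    using iso_splitting[OF f] .
  then show ?thesis
    by (rule splitting_section_inert) (rule m1[OF iso_obj(2)[OF f]])
qed

lemma active_comp:
  assumes f: "active C f" and g: "active C g" and fg: "Dom C g = Cod C f"
  shows "active C (g \<bullet> f)"
proof -
  have fh: "f \<in> Hom C (Dom C f) (Cod C f)" and gh: "g \<in> Hom C (Cod C f) (Cod C g)"
    using f g by (simp_all add: active_def Hom_def fg)
  show ?thesis
    using m3[OF fh gh m1[OF Hom_obj(1)[OF fh]]] HomD[OF comp_hom[OF fh gh]]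
    by (simp add: active_def push_active[OF f fh] push_active[OF g gh])
qed

text \<open>The retractions compose in reverse order. The formula for \<open>g\<close> applies to
  \<open>f\<^sub>*(\<phi>)\<close> because this is again a moment.\<close>

lemma inert_comp:
  assumes f: "inert C f" and g: "inert C g" and fg: "Dom C g = Cod C f"
  shows "inert C (g \<bullet> f)"
proof -
  define A B D where "A = Dom C f" "B = Cod C f" "D = Cod C g"
  have fh: "f \<in> Hom C A B" and gh: "g \<in> Hom C B D"
    using f g by (simp_all add: inert_def Hom_def fg A_B_D_def)
  note A = Hom_obj(1)[OF fh]
  obtain r where rh: "r \<in> Hom C B A" and rf: "r \<bullet> f = Ident C A"
    and r: "\<And>\<phi>. \<phi> \<in> Mom C A \<Longrightarrow> push C f \<phi> = f \<bullet> \<phi> \<bullet> r"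
    using f HomD[OF fh] unfolding inert_def by auto
  obtain s where sh: "s \<in> Hom C D B" and sg: "s \<bullet> g = Ident C B"
    and s: "\<And>\<phi>. \<phi> \<in> Mom C B \<Longrightarrow> push C g \<phi> = g \<bullet> \<phi> \<bullet> s"
    using g HomD[OF gh] unfolding inert_def by auto
  note gfh = comp_hom[OF fh gh]
  have "r \<bullet> s \<bullet> (g \<bullet> f) = r \<bullet> (s \<bullet> g \<bullet> f)"
    by (simp add: comp_assoc[OF gfh sh rh] comp_assoc[OF fh gh sh])
  then have "r \<bullet> s \<bullet> (g \<bullet> f) = Ident C A"
    by (simp add: sg ident_left[OF fh] rf)
  moreover have "push C (g \<bullet> f) \<phi> = g \<bullet> f \<bullet> \<phi> \<bullet> (r \<bullet> s)" if \<phi>: "\<phi> \<in> Mom C A" for \<phi>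
  proof -
    note \<phi>h = mom_hom[OF A \<phi>]
    note f\<phi>h = comp_hom[OF \<phi>h fh]
    have "push C (g \<bullet> f) \<phi> = g \<bullet> (f \<bullet> \<phi> \<bullet> r) \<bullet> s"
      using s[OF push_mom[OF fh \<phi>]] by (simp add: m3[OF fh gh \<phi>] r[OF \<phi>])
    also have "\<dots> = g \<bullet> (f \<bullet> \<phi>) \<bullet> r \<bullet> s"
      by (simp add: comp_assoc[OF rh f\<phi>h gh])
    also have "\<dots> = g \<bullet> f \<bullet> \<phi> \<bullet> (r \<bullet> s)"
      by (simp add: comp_assoc[OF \<phi>h fh gh] comp_assoc[OF sh rh comp_hom[OF f\<phi>h gh]])
    finally show ?thesis .
  qed
  ultimately show ?thesis
    using comp_hom[OF sh rh] HomD[OF gfh] unfolding inert_def by auto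
qed

lemma closed_active: "closed_class C {f. active C f}"
  by (simp add: closed_class_def active_comp iso_active)

lemma closed_inert: "closed_class C {f. inert C f}"
  by (simp add: closed_class_def inert_comp iso_inert)

section \<open>Active/inert factorisations\<close>

lemma active_inert_factorisation_iff:
  assumes f: "f \<in> Hom C A B"
  shows "has_active_inert_factorisation C f \<longleftrightarrow> splits C B (push C f (Ident C A))"
proof
  note A = Hom_obj(1)[OF f]
  assume "has_active_inert_factorisation C f"
  then obtain D g i where D: "D \<in> Obj C" and g: "g \<in> Hom C A D" "active C g"
    and i: "i \<in> Hom C D B" "inert C i" and eq: "f = i \<bullet> g"
    using HomD[OF f] unfolding has_active_inert_factorisation_def by auto
  \<comment> \<open>As \<open>g\<close> is active, \<open>f\<close> and its inert part
    \<open>i\<close> push identities to the same moment, which \<open>i\<close> splits.\<close>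
  have "push C f (Ident C A) = push C i (Ident C D)"
    by (simp add: eq m3[OF g(1) i(1) m1[OF A]] push_active[OF g(2,1)])
  moreover obtain r where "splitting C B (push C i (Ident C D)) D i r"
    using inert_splitting[OF i(2,1)] .
  ultimately show "splits C B (push C f (Ident C A))"
    using D unfolding splits_def by auto
next
  note A = Hom_obj(1)[OF f]
  note \<phi> = push_mom[OF f m1[OF A]]
  assume "splits C B (push C f (Ident C A))"
  then obtain D i r where D: "D \<in> Obj C"
    and split: "splitting C B (push C f (Ident C A)) D i r"
    unfolding splits_def by blast
  then have ih: "i \<in> Hom C D B" and rh: "r \<in> Hom C B D"
    and ir: "i \<bullet> r = push C f (Ident C A)"
    by (simp_all add: splitting_def)
  note rfh = comp_hom[OF f rh]
  \<comment> \<open>The retraction \<open>r\<close> sends the moment that it splits, here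
    \<open>f\<^sub>*(1)\<close>, to the identity.\<close>
  have "active C (r \<bullet> f)"
    using HomD[OF rfh]
    by (simp add: active_def m3[OF f rh m1[OF A]] splitting_push_retraction[OF split \<phi>])
  \<comment> \<open>Replacing \<open>i r\<close> by \<open>f\<^sub>*(1)\<close> leaves
    \<open>f\<^sub>*(1) f = f\<close>, which is (m4) at the identity.\<close>
  moreover have "f = i \<bullet> (r \<bullet> f)"
    using push_ident_comp[OF f] by (simp add: comp_assoc[OF f rh ih] flip: ir)
  ultimately show "has_active_inert_factorisation C f"
    using D rfh ih splitting_section_inert[OF split \<phi>] HomD[OF f]
    unfolding has_active_inert_factorisation_def by blast
qed

end

theorem lemma1p4:
  fixes C :: "('o, 'm, 'z) moment_category_scheme" (structure)
  assumes "moment_category C"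
  shows
    \<comment> \<open>(i)\<close>
    "(\<forall>A \<in> Obj C.
        monoid \<lparr>carrier = Mom C A, mult = Comp C, one = Ident C A\<rparr> \<and>
        (\<forall>\<phi> \<in> Mom C A. \<forall>\<psi> \<in> Mom C A. \<phi> \<bullet> \<psi> = \<phi> \<bullet> \<psi> \<bullet> \<phi>) \<and>
        (\<forall>\<phi> \<in> Mom C A. \<phi> \<bullet> \<phi> = \<phi>)) \<and>
    \<comment> \<open>(ii)\<close>
    (\<forall>A \<in> Obj C. \<forall>\<phi> \<in> Mom C A. \<forall>\<psi> \<in> Mom C A.
        \<psi> \<bullet> \<phi> = \<phi> \<longrightarrow> \<phi> \<bullet> \<psi> = \<psi> \<longrightarrow> \<phi> = \<psi>) \<and>
    \<comment> \<open>(iii)\<close>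
    (\<forall>A \<in> Obj C. \<forall>\<phi> \<in> Hom C A A. \<phi> \<in> Mom C A \<longleftrightarrow> push C \<phi> (Ident C A) = \<phi>) \<and>
    (\<forall>A \<in> Obj C. \<forall>B \<in> Obj C. \<forall>f \<in> Hom C A B. \<forall>\<phi> \<in> Mom C A.
        push C f \<phi> = push C (f \<bullet> \<phi>) (Ident C A)) \<and>
    \<comment> \<open>(iv)\<close>
    (\<forall>f. epimorphism C f \<longrightarrow> active C f) \<and>
    \<comment> \<open>(v)\<close>
    (\<forall>A \<in> Obj C. \<forall>B \<in> Obj C. \<forall>\<phi> \<in> Mom C A. \<forall>i r. splitting C A \<phi> B i r \<longrightarrow>
        active C r \<and> inert C i \<and>
        push C r \<phi> = Ident C B \<and> push C i (Ident C B) = \<phi>) \<and>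
    \<comment> \<open>(vi)\<close>
    closed_class C {f. active C f} \<and>
    closed_class C {f. inert C f} \<and>
    \<comment> \<open>(vii)\<close>
    (\<forall>A \<in> Obj C. \<forall>B \<in> Obj C. \<forall>f \<in> Hom C A B.
        has_active_inert_factorisation C f \<longleftrightarrow> splits C B (push C f (Ident C A)))"
proof -
  interpret moment_category C by fact
  show ?thesis
    by (intro conjI ballI allI impI)
      ((rule mom_monoid; assumption),
       (rule mom_skew_commute; assumption),
       (rule mom_idem; assumption),
       (rule mom_antisym; assumption),
       (rule mom_iff_push_ident; assumption),
       (rule push_eq_push_ident; assumption),
       (rule epimorphism_active; assumption),
       (rule splitting_retraction_active; assumption),
       (rule splitting_section_inert; assumption),
       (rule splitting_push_retraction; assumption),
       (rule splitting_push_section; assumption),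
       rule closed_active, rule closed_inert,
       (rule active_inert_factorisation_iff; assumption))
qed

end
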